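(* Let $n\ge 2$ be an integer. The total number of cycles of all even permutations of $[n]=\{1,2,\ldots,n\}$ and the total number of cycles of all odd permutations of $[n]$ differ by $(-1)^n(n-2)!$; that is, $$\sum_{\substack{\pi\in S_n\\ \pi \text{ even}}} \operatorname{cyc}(\pi)\;-\;\sum_{\substack{\pi\in S_n\\ \pi\text{ odd}}} \operatorname{cyc}(\pi) = (-1)^n (n-2)!.$$
   Context: $S_n$ denotes the set of all permutations of $[n]=\{1,2,\ldots,n\}$. For $\pi\in S_n$, $\operatorname{cyc}(\pi)$ denotes the number of cycles in the disjoint cycle decomposition of $\pi$, where fixed points count as cycles of length $1$. A permutation is even (odd) if its sign $(-1)^{n-\operatorname{cyc}(\pi)}$ is $+1$ ($-1$). *)

theory Defs
  imports "HOL-Combinatorics.Orbits"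
begin

text \<open>
  For a permutation \<open>p\<close> of a finite set \<open>A\<close>, the cycles of the disjoint cycle decomposition
  correspond to the orbits of \<open>p\<close> on \<open>A\<close>. A fixed point \<open>x\<close> contributes the orbit \<open>{x}\<close>, so
  cycles of length 1 are counted.
\<close>

definition cyc :: "'a set \<Rightarrow> ('a \<Rightarrow> 'a) \<Rightarrow> nat" where
  "cyc A p = card (orbit p ` A)"

text \<open>
  Even permutations are taken to be those satisfying \<^const>\<open>evenperm\<close>, which is defined via
  transpositions. The lemma \<open>sign_eq_cyc\<close> below shows that this agrees with the definition of
  the sign by the number of cycles.
\<close>

lemma orbit_transpose_comp:
  assumes q: "q permutes A" and x: "x \<notin> A" and b: "b \<in> A" and y: "y \<in> A"
  shows "orbit (transpose x b \<circ> q) y =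
    (if b \<in> orbit q y then insert x (orbit q y) else orbit q y)"
    (is "orbit ?p y = ?F")
proof
  have qx: "q x = x"
    using q x by (simp add: permutes_not_in)
  have orb: "orbit q y \<subseteq> A"
    using permutes_orbit_subset[OF q y] .
  have px: "?p x = b"
    by (simp add: qx)
  have pz: "?p z = (if q z = b then x else q z)" if "z \<in> A" for z
  proof -
    have "q z \<in> A"
      using that q by (simp add: permutes_in_image)
    then show ?thesis
      using x by (auto simp: transpose_def)
  qed
  have closed: "?p z \<in> ?F" if "z \<in> ?F" for z
  proof (cases "z = x")
    case True
    then show ?thesis
      using that px orb x by (auto split: if_splits)
  next
    case False
    then have z: "z \<in> orbit q y"
      using that by (auto split: if_splits)
    then have "q z \<in> orbit q y"
      by (rule orbit.step)
    moreover have "z \<in> A"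
      using z orb by blast
    ultimately show ?thesis
      unfolding pz[OF \<open>z \<in> A\<close>] by auto
  qed
  show "orbit ?p y \<subseteq> ?F"
  proof
    fix z assume "z \<in> orbit ?p y"
    then show "z \<in> ?F"
    proof induction
      case base
      then show ?case
        using pz[OF y] orbit.base[of q y] by auto
    next
      case (step z)
      then show ?case using closed by blast
    qed
  qed
  have main: "z \<in> orbit ?p y \<and> (z = b \<longrightarrow> x \<in> orbit ?p y)" if "z \<in> orbit q y" for z
  proof -
    have *: "q w \<in> orbit ?p y \<and> (q w = b \<longrightarrow> x \<in> orbit ?p y)"
      if "w \<in> A" "?p w \<in> orbit ?p y" for w
    proof (cases "q w = b")
      case True
      then have "x \<in> orbit ?p y"
        using that pz by simp
      moreover from orbit.step[OF this] have "b \<in> orbit ?p y"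
        using px by simp
      ultimately show ?thesis
        using True by simp
    next
      case False
      then show ?thesis
        using that pz by simp
    qed
    show ?thesis
      using that
    proof induction
      case base
      show ?case
        by (rule *[OF y orbit.base])
    next
      case (step w)
      show ?case
      proof (rule *)
        show "w \<in> A"
          using step.hyps orb by blast
        show "?p w \<in> orbit ?p y"
          using step.IH by (blast intro: orbit.step)
      qed
    qed
  qed
  show "?F \<subseteq> orbit ?p y"
    using main by auto
qed

lemma cyc_transpose_comp:
  assumes A: "finite A" and q: "q permutes A" and x: "x \<notin> A" and b: "b \<in> A"
  shows "cyc (insert x A) (transpose x b \<circ> q) = cyc A q"
proof -
  let ?p = "transpose x b \<circ> q" and ?F = "\<lambda>C. if b \<in> C then insert x C else C"
  have perm: "permutation ?p"
  proof (rule permutation_compose)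
    show "permutation (transpose x b)"
      by (rule permutation_swap_id)
    show "permutation q"
      using A q unfolding permutation_permutes by blast
  qed
  have "?p x = b"
    using q x by (simp add: permutes_not_in)
  then have "orbit ?p x = orbit ?p b"
    using permutation_orbit_step[OF perm, of x] by simp
  then have "orbit ?p ` insert x A = orbit ?p ` A"
    using b by auto
  also have "\<dots> = ?F ` orbit q ` A"
    unfolding image_image
    by (rule image_cong[OF refl]) (rule orbit_transpose_comp[OF q x b])
  finally have eq: "orbit ?p ` insert x A = ?F ` orbit q ` A" .
  have "C \<subseteq> A" if "C \<in> orbit q ` A" for C
    using that permutes_orbit_subset[OF q] by blast
  then have "?F C - {x} = C" if "C \<in> orbit q ` A" for C
    using that x by auto
  then have "inj_on ?F (orbit q ` A)"
    by (rule inj_on_inverseI)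
  then show ?thesis
    unfolding cyc_def eq by (rule card_image)
qed

lemma cyc_insert_fixed:
  assumes A: "finite A" and q: "q permutes A" and x: "x \<notin> A"
  shows "cyc (insert x A) q = Suc (cyc A q)"
proof -
  have qx: "q x = x"
    using q x by (simp add: permutes_not_in)
  have "z = x" if "z \<in> orbit q x" for z
    using that by induction (simp_all add: qx)
  then have "orbit q x = {x}"
    using orbit_nonempty[of q x] by blast
  moreover have "{x} \<notin> orbit q ` A"
    using permutes_orbit_subset[OF q] x by blast
  ultimately show ?thesis
    using A by (simp add: cyc_def)
qed

lemma cyc_le_card: "finite A \<Longrightarrow> cyc A p \<le> card A"
  by (simp add: cyc_def card_image_le)

lemma sign_eq_cyc:
  assumes "finite A" and "p permutes A"
  shows "sign p = (- 1) ^ (card A - cyc A p)"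
  using assms
proof (induction A arbitrary: p rule: finite_induct)
  case empty
  then show ?case by (simp add: cyc_def)
next
  case (insert x A)
  have "p \<in> {p. p permutes insert x A}"
    using insert.prems by simp
  then obtain b q where
    p: "p = transpose x b \<circ> q" and b: "b \<in> insert x A" and q: "q permutes A"
    unfolding permutes_insert by auto
  have IH: "sign q = (- 1) ^ (card A - cyc A q)"
    using insert.IH q .
  show ?case
  proof (cases "b = x")
    case True
    then have "p = q"
      using p by simp
    then show ?thesis
      using IH cyc_insert_fixed[OF insert.hyps(1) q insert.hyps(2)] insert.hyps by simp
  next
    case False
    then have "b \<in> A"
      using b by simp
    then have c: "cyc (insert x A) p = cyc A q"
      using cyc_transpose_comp[OF insert.hyps(1) q insert.hyps(2)] p by simp
    have "permutation q"
      using q insert.hyps(1) unfolding permutation_permutes by blast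
    then have "sign p = - sign q"
      using p False by (simp add: sign_compose permutation_swap_id sign_swap_id)
    moreover have "card (insert x A) - cyc (insert x A) p = Suc (card A - cyc A q)"
      using c cyc_le_card[OF insert.hyps(1), of q] insert.hyps by simp
    ultimately show ?thesis
      using IH by simp
  qed
qed

end

theory Submission
  imports Defs
begin

text \<open>
  Since \<^const>\<open>sign\<close> is \<open>1\<close> on even and \<open>- 1\<close> on odd permutations, the difference is the sum of
  \<open>sign p * cyc p\<close> over all permutations of \<open>[n]\<close>. It is computed by adding one point to the
  ground set at a time. A new point \<open>x\<close> is either made a fixed point of a permutation \<open>q\<close> of the
  old set \<open>A\<close>, which keeps the sign and adds a cycle, or it is spliced into a cycle of \<open>q\<close> next to
  one of the \<open>card A\<close> old points, which flips the sign and keeps the number of cycles. Hence the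
  signed sum of a statistic \<open>f (cyc p)\<close> over the larger set is the signed sum of
  \<open>f (cyc q + 1) - card A * f (cyc q)\<close> over the smaller one
  (\<open>sum_sign_cyc_insert\<close>).

  For \<open>f = 1\<close> the factor is \<open>1 - card A\<close>, so that the signed count of permutations, which is \<open>1\<close> for
  at most one point, is \<open>0\<close> from two points on. For \<open>f k = k\<close>, writing \<open>c\<^sub>m\<close> for the desired sum and
  \<open>e\<^sub>m\<close> for the signed count on \<open>m\<close> points, the recurrence reads
  \<open>c\<^bsub>m+1\<^esub> = (1 - m) * c\<^sub>m + e\<^sub>m\<close>. It gives \<open>c\<^sub>2 = e\<^sub>1 = 1\<close>, and after that the term \<open>e\<^sub>m\<close> is \<open>0\<close> and
  each step multiplies by \<open>- (m - 1)\<close>, which produces \<open>(- 1) ^ n * (n - 2)!\<close>.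
  Equivalently, the signed generating polynomial of \<^const>\<open>cyc\<close> is the falling factorial
  \<open>t (t - 1) \<cdots> (t - n + 1)\<close>, and the theorem evaluates its derivative at \<open>t = 1\<close>.
\<close>

text \<open>
  Every permutation of \<open>insert x A\<close> is uniquely \<open>transpose x b \<circ> q\<close> with \<open>q\<close> permuting \<open>A\<close> and \<open>b\<close>
  in \<open>insert x A\<close>. The choice \<open>b = x\<close> contributes the first term on the right, and the
  \<open>card A\<close> other choices contribute equally to the second.
\<close>

lemma sum_sign_cyc_insert:
  fixes f :: "nat \<Rightarrow> int"
  assumes A: "finite A" and x: "x \<notin> A"
  shows "(\<Sum>p | p permutes insert x A. sign p * f (cyc (insert x A) p)) =
    (\<Sum>q | q permutes A. sign q * (f (Suc (cyc A q)) - int (card A) * f (cyc A q)))"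
proof -
  let ?w = "\<lambda>p. sign p * f (cyc (insert x A) p)"
  have fixed: "?w (transpose x x \<circ> q) = sign q * f (Suc (cyc A q))" if "q permutes A" for q
    using cyc_insert_fixed[OF A that x] by simp
  have spliced: "?w (transpose x b \<circ> q) = - (sign q * f (cyc A q))"
    if q: "q permutes A" and b: "b \<in> A" for q b
  proof -
    have "permutation q"
      using q A unfolding permutation_permutes by blast
    moreover have "x \<noteq> b"
      using b x by blast
    ultimately have "sign (transpose x b \<circ> q) = - sign q"
      by (simp add: sign_compose permutation_swap_id sign_swap_id)
    then show ?thesis
      using cyc_transpose_comp[OF A q x b] by simp
  qed
  have "(\<Sum>p | p permutes insert x A. ?w p) =
      (\<Sum>b\<in>insert x A. \<Sum>q | q permutes A. ?w (transpose x b \<circ> q))"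
    by (rule sum_over_permutations_insert[OF A x])
  also have "\<dots> = (\<Sum>q | q permutes A. ?w (transpose x x \<circ> q)) +
      (\<Sum>b\<in>A. \<Sum>q | q permutes A. ?w (transpose x b \<circ> q))"
    by (rule sum.insert[OF A x])
  also have "(\<Sum>q | q permutes A. ?w (transpose x x \<circ> q)) =
      (\<Sum>q | q permutes A. sign q * f (Suc (cyc A q)))"
    by (rule sum.cong) (use fixed in auto)
  also have "(\<Sum>b\<in>A. \<Sum>q | q permutes A. ?w (transpose x b \<circ> q)) =
      (\<Sum>b\<in>A. \<Sum>q | q permutes A. - (sign q * f (cyc A q)))"
    by (intro sum.cong) (use spliced in auto)
  finally show ?thesis
    by (simp add: right_diff_distrib sum_subtractf sum_negf sum_distrib_left mult.left_commute)
qed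

lemma sum_sign_permutations:
  assumes "finite A"
  shows "(\<Sum>p | p permutes A. sign p) = (if card A \<le> 1 then 1 else 0)"
  using assms
proof (induction A rule: finite_induct)
  case empty
  then show ?case by simp
next
  case (insert x A)
  have "(\<Sum>p | p permutes insert x A. sign p) = (1 - int (card A)) * (\<Sum>q | q permutes A. sign q)"
    using sum_sign_cyc_insert[OF insert.hyps, of "\<lambda>_. 1"]
    by (simp add: mult.commute flip: sum_distrib_right)
  then show ?case
    using insert by (auto simp: le_Suc_eq)
qed

lemma sum_sign_cyc_insert_eq:
  assumes "finite A" and "x \<notin> A"
  shows "(\<Sum>p | p permutes insert x A. sign p * int (cyc (insert x A) p)) =
    (1 - int (card A)) * (\<Sum>q | q permutes A. sign q * int (cyc A q)) +
    (if card A \<le> 1 then 1 else 0)"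
proof -
  have "(\<Sum>p | p permutes insert x A. sign p * int (cyc (insert x A) p)) =
      (\<Sum>q | q permutes A. (1 - int (card A)) * (sign q * int (cyc A q)) + sign q)"
    unfolding sum_sign_cyc_insert[OF assms] by (intro sum.cong) (simp_all add: algebra_simps)
  then show ?thesis
    by (simp only: sum.distrib sum_distrib_left[symmetric] sum_sign_permutations[OF assms(1)])
qed

lemma sum_sign_cyc:
  fixes n :: nat
  assumes "n \<ge> 2"
  shows "(\<Sum>p | p permutes {1..n}. sign p * int (cyc {1..n} p)) = (- 1) ^ n * fact (n - 2)"
  using assms
proof (induction n rule: dec_induct)
  case base
  have "{1..2::nat} = insert 2 {1}"
    by auto
  \<comment> \<open>The step from one point to two has factor \<open>1 - 1 = 0\<close>, so only the signed count remains.\<close>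
  then show ?case
    using sum_sign_cyc_insert_eq[of "{1::nat}" 2] by simp
next
  case (step n)
  have "{1..Suc n} = insert (Suc n) {1..n}"
    by auto
  then have "(\<Sum>p | p permutes {1..Suc n}. sign p * int (cyc {1..Suc n} p)) =
      (1 - int n) * ((- 1) ^ n * fact (n - 2))"
    using sum_sign_cyc_insert_eq[of "{1..n}" "Suc n"] step by simp
  moreover have "fact (Suc n - 2) = (int n - 1) * fact (n - 2)"
    using step.hyps fact_reduce[of "n - 1", where ?'a = int]
    by (simp add: of_nat_diff numeral_2_eq_2)
  ultimately show ?case
    by (simp only: power_Suc) (simp add: algebra_simps)
qed

theorem theorem1:
  fixes n :: nat
  assumes "n \<ge> 2"
  shows "(\<Sum>p | p permutes {1..n} \<and> evenperm p. int (cyc {1..n} p))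
       - (\<Sum>p | p permutes {1..n} \<and> \<not> evenperm p. int (cyc {1..n} p))
       = (- 1) ^ n * fact (n - 2)"
proof -
  let ?c = "\<lambda>p. int (cyc {1..n} p)" and ?S = "{p. p permutes {1..n}}"
  have "(\<Sum>p\<in>?S. sign p * ?c p) = (\<Sum>p\<in>?S. if evenperm p then ?c p else - ?c p)"
    by (rule sum.cong) (simp_all add: sign_def)
  also have "\<dots> = sum ?c (?S \<inter> {p. evenperm p}) + (\<Sum>p\<in>?S \<inter> - {p. evenperm p}. - ?c p)"
    by (rule sum.If_cases) (simp add: finite_permutations)
  also have "\<dots> = (\<Sum>p | p permutes {1..n} \<and> evenperm p. ?c p)
      - (\<Sum>p | p permutes {1..n} \<and> \<not> evenperm p. ?c p)"
    by (simp add: sum_negf Collect_conj_eq Collect_neg_eq)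
  finally show ?thesis
    using sum_sign_cyc[OF assms] by simp
qed

end
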